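(* For every partition $\mu=(\mu_1,\mu_2,\mu_3)$ of at most three parts, the cardinality of $\mathcal{T}_3(\mu;n-|\mu|)$ can be expressed as a linear combination of negative shifts of the Motzkin numbers $m_n$ with constant coefficients, and each formula can be proved combinatorially.
   Context: The Motzkin numbers $m_n$ ($n\ge 0$) are defined by the generating function $M=\sum_{n\ge 0}m_nx^n=\frac{1-x-\sqrt{1-2x-3x^2}}{2x^2}$, which satisfies $M=1+xM+x^2M^2$. Combinatorially, $m_n$ is the number of Motzkin paths of length $n$, i.e. lattice paths from $(0,0)$ to $(n,0)$ with steps $(1,1)$, $(1,-1)$, $(1,0)$ that never go below the $x$-axis. For a partition $\mu=(\mu_1,\mu_2,\mu_3)$ with $\mu_1\ge\mu_2\ge\mu_3\ge 0$, let $|\mu|=\mu_1+\mu_2+\mu_3$. $\mathcal{T}_3(\mu;n-|\mu|)$ denotes the set of standard Young tableaux with $n-|\mu|$ entries in the skew three-rowed strip $\mathcal{T}_3/\mu$, i.e. the set of all standard Young tableaux of skew shape $\lambda/\mu$ (fillings of the cells of $\lambda/\mu$ by $1,2,\dots,n-|\mu|$, each used once, increasing along rows and down columns), where $\lambda$ ranges over all partitions of $n$ with at most three parts whose diagram contains that of $\mu$. "Negative shifts of the Motzkin numbers $m_n$" refers to terms such as $m_{n-1}$, $m_{n-3}$, and "constant coefficients" means coefficients that do not depend on $n$; for example, $|\mathcal{T}_3((2,1,0);n-3)|=m_{n-1}-m_{n-3}$. *)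

theory Defs
  imports Complex_Main "HOL-Library.FuncSet" "HOL-Computational_Algebra.Formal_Power_Series"
begin

definition motzkin_gf :: "real fps" where
  "motzkin_gf =
     (1 - fps_X - fps_radical root 2 (1 - 2 * fps_X - 3 * fps_X ^ 2)) / (2 * fps_X ^ 2)"

definition motzkin :: "nat \<Rightarrow> real" where
  "motzkin n = fps_nth motzkin_gf n"

(* A path is the list of the vertical components of its steps (1,1), (1,0), (1,-1). *)
definition motzkin_paths :: "nat \<Rightarrow> int list set" where
  "motzkin_paths n =
     {p. length p = n \<and> set p \<subseteq> {1, 0, -1} \<and>
         (\<forall>k\<le>n. 0 \<le> sum_list (take k p)) \<and> sum_list p = 0}"

(* A partition with at most three parts, padded with zeros to length exactly three;
   its size is the sum of the list. *)
definition partition3 :: "nat list \<Rightarrow> bool" where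
  "partition3 \<mu> \<longleftrightarrow> length \<mu> = 3 \<and> sorted_wrt (\<ge>) \<mu>"

(* Cells are (row, column), both counted from 0. *)
definition diagram :: "nat list \<Rightarrow> (nat \<times> nat) set" where
  "diagram \<nu> = {(i, j). i < length \<nu> \<and> j < \<nu> ! i}"

definition skew_SYT :: "nat list \<Rightarrow> nat list \<Rightarrow> (nat \<times> nat \<Rightarrow> nat) set" where
  "skew_SYT \<nu> \<mu> =
     (let D = diagram \<nu> - diagram \<mu> in
      {T \<in> extensional D.
         bij_betw T D {1..card D} \<and>
         (\<forall>i j j'. (i, j) \<in> D \<longrightarrow> (i, j') \<in> D \<longrightarrow> j < j' \<longrightarrow> T (i, j) < T (i, j')) \<and>
         (\<forall>i i' j. (i, j) \<in> D \<longrightarrow> (i', j) \<in> D \<longrightarrow> i < i' \<longrightarrow> T (i, j) < T (i', j))})"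

(* The outer shape is recorded with the filling: extensional functions on different
   cell sets of the same size may coincide as functions. *)
definition strip_SYT :: "nat list \<Rightarrow> nat \<Rightarrow> (nat list \<times> (nat \<times> nat \<Rightarrow> nat)) set" where
  "strip_SYT \<mu> m =
     (SIGMA \<nu>:{\<nu>. partition3 \<nu> \<and> sum_list \<nu> = sum_list \<mu> + m \<and> diagram \<mu> \<subseteq> diagram \<nu>}.
        skew_SYT \<nu> \<mu>)"

lemma motzkin_gf_eq:
  "motzkin_gf = 1 + fps_X * motzkin_gf + fps_X ^ 2 * motzkin_gf ^ 2"
proof -
  define A :: "real fps" where "A = 1 - 2 * fps_X - 3 * fps_X ^ 2"
  define S where "S = fps_radical root 2 A"
  define N where "N = 1 - fps_X - S"
  have A0: "fps_nth A 0 = 1" by (simp add: A_def fps_numeral_nth)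
  have S2: "S ^ 2 = A"
    using power_radical[of A root 1] A0 by (simp add: S_def numeral_2_eq_2)
  have S0: "fps_nth S 0 = 1" by (simp add: S_def A0)
  have "fps_nth (S ^ 2) 1 = -2"
    unfolding S2 by (simp add: A_def fps_numeral_nth fps_numeral_fps_const)
  hence S1: "fps_nth S 1 = -1"
    using S0 by (simp add: power2_eq_square fps_mult_nth)
  have "fps_X ^ 2 dvd N"
  proof (cases "N = 0")
    case False
    have "fps_nth N i = 0" if "i < 2" for i
      using that S0 S1 by (auto simp: N_def less_2_cases_iff)
    then have "2 \<le> subdegree N" using False by (intro subdegree_geI) auto
    then show ?thesis using False by (simp add: fps_dvd_iff)
  qed simp
  then obtain K where K: "N = fps_X ^ 2 * K" by (elim dvdE)
  define c where "c = fps_const (1 / 2 :: real)"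
  have c2: "2 * c = 1" by (simp add: c_def fps_numeral_fps_const fps_const_mult)
  have "N = c * K * (2 * fps_X ^ 2)"
    using c2 K by algebra
  moreover have nz: "(2 * fps_X ^ 2 :: real fps) \<noteq> 0"
    by simp
  ultimately have M: "motzkin_gf * (2 * fps_X ^ 2) = N"
    unfolding motzkin_gf_def N_def S_def A_def by (metis dvd_div_mult_self dvd_triv_right)
  have "(1 - fps_X - motzkin_gf * (2 * fps_X ^ 2)) ^ 2 = A"
    using S2 unfolding M N_def by simp
  hence "(2 * fps_X ^ 2) * (2 * motzkin_gf) =
         (2 * fps_X ^ 2) * (2 * (1 + fps_X * motzkin_gf + fps_X ^ 2 * motzkin_gf ^ 2))"
    unfolding A_def by algebra
  hence "2 * motzkin_gf = 2 * (1 + fps_X * motzkin_gf + fps_X ^ 2 * motzkin_gf ^ 2)"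
    using nz by (metis mult_left_cancel)
  thus ?thesis by (metis mult_left_cancel zero_neq_numeral)
qed

end

theory Submission
  imports Defs
begin

text \<open>
  Let \<open>D m h\<close> (\<open>descents m h\<close>) be the number of Motzkin paths of length \<open>m\<close> that start at
  height \<open>h\<close> instead of \<open>0\<close> and end at height \<open>0\<close>. The heart of the matter is the formula
    \<open>card (strip_SYT [x, y, z] m) = (\<Sum>i\<le>x-y. \<Sum>j\<le>y-z. D m (i + j))\<close>
  (\<open>card_strip_SYT_eq_descent_sum\<close>). It comes from representation theory. Let \<open>SL\<^sub>2\<close> act on
  \<open>V = \<complex>\<^sup>2 \<oplus> \<complex>\<close>. By the branching rule from \<open>GL\<^sub>3\<close> to \<open>GL\<^sub>2\<close>, every Schur
  functor of a partition with at most three parts, applied to \<open>V\<close>, contains the trivial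
  representation of \<open>SL\<^sub>2\<close> exactly once. So, by the Pieri rule, the tableaux counted on the left
  correspond to a basis of the invariants in \<open>S\<^sub>\<mu>(V) \<otimes> V\<^bsup>\<otimes>m\<^esup>\<close>. On the other hand
  \<open>S\<^sub>\<mu>(V)\<close> restricts to the sum over \<open>i\<close> and \<open>j\<close> of the irreducible representations of
  highest weight \<open>i + j\<close>, and tensoring with \<open>V\<close> moves a highest weight by \<open>1\<close>, \<open>0\<close> or
  \<open>-1\<close>, just like a Motzkin step.

  Given the formula, a proof needs no representation theory: both sides are \<open>1\<close> for \<open>m = 0\<close>,
  and both satisfy the same recursion in \<open>m\<close>. For tableaux, the recursion moves the cell holding
  the smallest entry into the inner shape (\<open>card_strip_SYT_Suc\<close>); for the double sum, it is an
  identity between finite sums (\<open>descent_sum_Suc\<close>).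

  Reading the recursion of \<open>D\<close> by the first step of a path as an expression for
  \<open>D m (h + 1)\<close> turns every \<open>D m h\<close> into an integer combination of \<open>D m 0, \<dots>, D (m + h) 0\<close>
  (\<open>descents_in_shift_span\<close>), that is, of Motzkin numbers. In the double sum
  \<open>h \<le> x - z \<le> x + y + z\<close>, so with \<open>n = m + x + y + z\<close> only the numbers from
  \<open>m\<^bsub>n - (x+y+z)\<^esub>\<close> to \<open>m\<^sub>n\<close> occur. The bijection exists because moving the
  negative terms to the side of the tableaux makes the identity one between sizes of finite sets.
\<close>

section \<open>Linear extensions\<close>

text \<open>
  The relation \<open>r\<close> only needs to generate the order, so the row and column conditions of a tableau
  can be used as they stand.
\<close>

definition linear_extensions :: "('a \<Rightarrow> 'a \<Rightarrow> bool) \<Rightarrow> 'a set \<Rightarrow> ('a \<Rightarrow> nat) set" where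
  "linear_extensions r D =
     {T \<in> extensional D. bij_betw T D {1..card D} \<and>
        (\<forall>x\<in>D. \<forall>y\<in>D. r x y \<longrightarrow> T x < T y)}"

lemma finite_linear_extensions:
  assumes "finite D"
  shows "finite (linear_extensions r D)"
proof (rule finite_subset)
  show "linear_extensions r D \<subseteq> (\<Pi>\<^sub>E x\<in>D. {1..card D})"
    by (auto simp: linear_extensions_def PiE_def bij_betw_def)
qed (use assms in \<open>auto intro: finite_PiE\<close>)

lemma linear_extensions_empty: "linear_extensions r {} = {\<lambda>_. undefined}"
  by (auto simp: linear_extensions_def bij_betw_def)

lemma bij_betw_pred_shift: "bij_betw (\<lambda>k::nat. k - 1) ({1..Suc n} - {1}) {1..n}"
  by (rule bij_betw_byWitness[where f' = Suc]) auto

lemma bij_betw_Suc_shift: "bij_betw Suc {1..n} ({1..Suc n} - {1})"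
  by (rule bij_betw_byWitness[where f' = "\<lambda>k. k - 1"]) auto

text \<open>
  Deleting the label \<open>1\<close> and lowering the others by one is inverted by raising all labels and
  giving \<open>c\<close> the label \<open>1\<close>; the latter respects \<open>r\<close> because \<open>c\<close> is minimal.
\<close>

lemma linear_extensions_delete_first:
  assumes D: "finite D" and c: "c \<in> D" "\<And>x. x \<in> D \<Longrightarrow> \<not> r x c"
  shows "card {T \<in> linear_extensions r D. T c = 1} = card (linear_extensions r (D - {c}))"
proof -
  obtain n where n: "card (D - {c}) = n" "card D = Suc n"
    using D c(1) by (metis card_Suc_Diff1)
  define lower where "lower T = restrict (\<lambda>x. T x - 1 :: nat) (D - {c})" for T
  define raise where "raise T = restrict (\<lambda>x. if x = c then 1 else Suc (T x)) D" for T
  have low: "lower T \<in> linear_extensions r (D - {c})"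
    if T: "T \<in> linear_extensions r D" "T c = 1" for T
  proof -
    have bij: "bij_betw T D {1..card D}"
      and ord: "\<And>x y. x \<in> D \<Longrightarrow> y \<in> D \<Longrightarrow> r x y \<Longrightarrow> T x < T y"
      using T by (auto simp: linear_extensions_def)
    have "bij_betw T {c} {1}" using T(2) by (simp add: bij_betw_def)
    from bij_betw_DiffI[OF bij this] have "bij_betw T (D - {c}) ({1..card D} - {1})"
      using c(1) n by simp
    from bij_betw_trans[OF this[unfolded n] bij_betw_pred_shift]
    have b: "bij_betw (lower T) (D - {c}) {1..n}"
      by (rule bij_betw_cong[THEN iffD1, rotated]) (auto simp: lower_def)
    have pos: "T x \<ge> 1" if "x \<in> D" for x
      using bij n that by (auto simp: bij_betw_def)
    have "lower T x < lower T y" if "x \<in> D - {c}" "y \<in> D - {c}" "r x y" for x y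
      using ord[of x y] pos[of x] pos[of y] that by (auto simp: lower_def)
    with b n show ?thesis by (auto simp: linear_extensions_def lower_def)
  qed
  have up: "raise T \<in> linear_extensions r D \<and> raise T c = 1"
    if T: "T \<in> linear_extensions r (D - {c})" for T
  proof -
    have bij: "bij_betw T (D - {c}) {1..card (D - {c})}"
      and ord: "\<And>x y. x \<in> D - {c} \<Longrightarrow> y \<in> D - {c} \<Longrightarrow> r x y \<Longrightarrow> T x < T y"
      using T by (auto simp: linear_extensions_def)
    from bij_betw_trans[OF bij[unfolded n] bij_betw_Suc_shift]
    have 1: "bij_betw (raise T) (D - {c}) ({1..card D} - {1})"
      unfolding n by (rule bij_betw_cong[THEN iffD1, rotated]) (auto simp: raise_def)
    have 2: "bij_betw (raise T) {c} {1}"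
      using c(1) by (auto simp: raise_def bij_betw_def)
    have b: "bij_betw (raise T) D {1..card D}"
      using bij_betw_combine[OF 1 2] c(1) n by (auto simp: insert_absorb)
    have pos: "T x \<ge> 1" if "x \<in> D - {c}" for x
      using bij n that by (auto simp: bij_betw_def)
    have "raise T x < raise T y" if "x \<in> D" "y \<in> D" "r x y" for x y
    proof -
      have "y \<noteq> c" using c(2)[OF that(1)] that(3) by auto
      then show ?thesis using ord[of x y] pos[of y] that by (auto simp: raise_def)
    qed
    with b c(1) n show ?thesis by (auto simp: linear_extensions_def raise_def)
  qed
  have "bij_betw lower {T \<in> linear_extensions r D. T c = 1} (linear_extensions r (D - {c}))"
  proof (rule bij_betw_byWitness[where f' = raise])
    show "\<forall>T\<in>{T \<in> linear_extensions r D. T c = 1}. raise (lower T) = T"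
    proof
      fix T assume T: "T \<in> {T \<in> linear_extensions r D. T c = 1}"
      then have "T x \<ge> 1" if "x \<in> D" for x
        using that by (auto simp: linear_extensions_def bij_betw_def)
      moreover have "T \<in> extensional D" using T by (auto simp: linear_extensions_def)
      ultimately show "raise (lower T) = T"
        using T by (fastforce simp: raise_def lower_def fun_eq_iff extensional_def)
    qed
    show "\<forall>T\<in>linear_extensions r (D - {c}). lower (raise T) = T"
      by (auto simp: raise_def lower_def fun_eq_iff linear_extensions_def extensional_def)
  qed (use low up in auto)
  then show ?thesis by (rule bij_betw_same_card)
qed

text \<open>
  The label \<open>1\<close> must sit at a minimal element, and it can sit at any of them.
\<close>

lemma card_linear_extensions_rec:
  assumes D: "finite D" "D \<noteq> {}"
  shows "card (linear_extensions r D) =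
           (\<Sum>c\<in>{c \<in> D. \<forall>x\<in>D. \<not> r x c}. card (linear_extensions r (D - {c})))"
proof -
  let ?M = "{c \<in> D. \<forall>x\<in>D. \<not> r x c}"
  let ?A = "\<lambda>c. {T \<in> linear_extensions r D. T c = 1}"
  have "T \<in> (\<Union>c\<in>?M. ?A c)" if T: "T \<in> linear_extensions r D" for T
  proof -
    have bij: "bij_betw T D {1..card D}"
      and ord: "\<And>x y. x \<in> D \<Longrightarrow> y \<in> D \<Longrightarrow> r x y \<Longrightarrow> T x < T y"
      using T by (auto simp: linear_extensions_def)
    have "1 \<in> {1..card D}" using D by (simp add: Suc_le_eq card_gt_0_iff)
    then have "1 \<in> T ` D" using bij by (simp add: bij_betw_def)
    then obtain c where c: "c \<in> D" "T c = 1" by (metis imageE)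
    have "\<not> r x c" if "x \<in> D" for x
      using ord[OF that c(1)] c(2) bij_betwE[OF bij] that by fastforce
    with c T show ?thesis by auto
  qed
  then have "linear_extensions r D = (\<Union>c\<in>?M. ?A c)" by auto
  also have "card \<dots> = (\<Sum>c\<in>?M. card (?A c))"
  proof (rule card_UN_disjoint)
    show "\<forall>i\<in>?M. \<forall>j\<in>?M. i \<noteq> j \<longrightarrow> ?A i \<inter> ?A j = {}"
      by (auto simp: linear_extensions_def bij_betw_def inj_on_def)
  qed (use D finite_linear_extensions[OF D(1), of r] in auto)
  also have "\<dots> = (\<Sum>c\<in>?M. card (linear_extensions r (D - {c})))"
  proof (rule sum.cong[OF refl])
    fix c assume "c \<in> ?M"
    then have "c \<in> D" "\<And>x. x \<in> D \<Longrightarrow> \<not> r x c" by blast+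
    then show "card (?A c) = card (linear_extensions r (D - {c}))"
      by (rule linear_extensions_delete_first[OF D(1)])
  qed
  finally show ?thesis .
qed

section \<open>Growing a shape by one cell\<close>

definition precedes :: "nat \<times> nat \<Rightarrow> nat \<times> nat \<Rightarrow> bool" where
  "precedes x y \<longleftrightarrow>
     fst x = fst y \<and> snd x < snd y \<or> snd x = snd y \<and> fst x < fst y"

lemma skew_SYT_eq: "skew_SYT \<nu> \<mu> = linear_extensions precedes (diagram \<nu> - diagram \<mu>)"
  unfolding skew_SYT_def linear_extensions_def Let_def precedes_def
  by (rule Collect_cong) fastforce

lemma partition3_iff: "partition3 \<mu> \<longleftrightarrow> (\<exists>x y z. \<mu> = [x, y, z] \<and> x \<ge> y \<and> y \<ge> z)"
  unfolding partition3_def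
  by (auto simp: numeral_3_eq_3 length_Suc_conv)

lemma finite_diagram: "finite (diagram \<nu>)"
proof -
  have "diagram \<nu> = (SIGMA i:{..<length \<nu>}. {..<\<nu> ! i})" by (auto simp: diagram_def)
  then show ?thesis by simp
qed

lemma mem_diagram3:
  "(i, j) \<in> diagram [x, y, z] \<longleftrightarrow> i = 0 \<and> j < x \<or> i = 1 \<and> j < y \<or> i = 2 \<and> j < z"
  by (auto simp: diagram_def less_Suc_eq numeral_2_eq_2)

lemma diagram3_subset_iff:
  "diagram [x, y, z] \<subseteq> diagram [u, v, w] \<longleftrightarrow> x \<le> u \<and> y \<le> v \<and> z \<le> w"
proof
  assume s: "diagram [x, y, z] \<subseteq> diagram [u, v, w]"
  have "\<not> u < x" using subsetD[OF s, of "(0, u)"] by (auto simp: mem_diagram3)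
  moreover have "\<not> v < y" using subsetD[OF s, of "(1, v)"] by (auto simp: mem_diagram3)
  moreover have "\<not> w < z" using subsetD[OF s, of "(2, w)"] by (auto simp: mem_diagram3)
  ultimately show "x \<le> u \<and> y \<le> v \<and> z \<le> w" by simp
qed (auto simp: mem_diagram3)

lemma diagram_inject:
  assumes "partition3 \<mu>" "partition3 \<nu>" "diagram \<mu> = diagram \<nu>"
  shows "\<mu> = \<nu>"
proof -
  have "diagram \<mu> \<subseteq> diagram \<nu>" "diagram \<nu> \<subseteq> diagram \<mu>" using assms(3) by simp_all
  then show ?thesis
    using assms(1,2) unfolding partition3_iff by (elim exE conjE) (simp add: diagram3_subset_iff)
qed

definition grow :: "nat list \<Rightarrow> nat \<Rightarrow> nat list" where
  "grow \<mu> i = \<mu>[i := Suc (\<mu> ! i)]"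

definition addable_rows :: "nat list \<Rightarrow> nat set" where
  "addable_rows \<mu> = {i. i < 3 \<and> partition3 (grow \<mu> i)}"

lemma less_3_iff: "(i::nat) < 3 \<longleftrightarrow> i = 0 \<or> i = 1 \<or> i = 2"
  by auto

lemma addable_rows_eq:
  assumes "z \<le> y" "y \<le> x"
  shows "addable_rows [x, y, z] =
           insert 0 ((if y < x then {1} else {}) \<union> (if z < y then {2} else {}))"
  using assms
  by (auto simp: addable_rows_def partition3_iff grow_def less_3_iff numeral_2_eq_2)

lemma diagram_grow:
  assumes "i < length \<mu>"
  shows "diagram (grow \<mu> i) = insert (i, \<mu> ! i) (diagram \<mu>)"
  using assms by (auto simp: diagram_def grow_def nth_list_update split: if_splits)

lemma sum_list_grow: "i < length \<mu> \<Longrightarrow> sum_list (grow \<mu> i) = Suc (sum_list \<mu>)"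
  by (simp add: grow_def sum_list_update)

text \<open>
  A skew tableau can carry its smallest entry in a cell exactly if that cell can be added to the
  inner shape. In a row of the skew shape only the leftmost cell, in column \<open>\<mu> ! i\<close>, has no
  predecessor in its row; it has none in its column exactly if the row above is already longer
  in \<open>\<mu>\<close>, because \<open>\<nu>\<close> is a partition and so the cell above belongs to \<open>\<nu>\<close>.
\<close>

lemma minimal_cells_eq:
  assumes "partition3 \<mu>" "partition3 \<nu>" "diagram \<mu> \<subseteq> diagram \<nu>"
  shows "{c \<in> diagram \<nu> - diagram \<mu>. \<forall>x\<in>diagram \<nu> - diagram \<mu>. \<not> precedes x c} =
           (\<lambda>i. (i, \<mu> ! i)) ` {i \<in> addable_rows \<mu>. diagram (grow \<mu> i) \<subseteq> diagram \<nu>}"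
  (is "?L = ?R")
proof -
  obtain x y z where mu: "\<mu> = [x, y, z]" "z \<le> y" "y \<le> x"
    using assms(1) by (auto simp: partition3_iff)
  obtain u v w where nu: "\<nu> = [u, v, w]" "w \<le> v" "v \<le> u"
    using assms(2) by (auto simp: partition3_iff)
  have le: "x \<le> u" "y \<le> v" "z \<le> w" using assms(3) mu nu by (auto simp: diagram3_subset_iff)
  let ?D = "diagram \<nu> - diagram \<mu>"
  have "(i, j) \<in> ?L \<longleftrightarrow> (i, j) \<in> ?R" for i j
  proof
    assume L: "(i, j) \<in> ?L"
    then have min: "\<not> precedes (i', j') (i, j)" if "(i', j') \<in> ?D" for i' j'
      using that by blast
    have D: "(i, j) \<in> ?D" using L by blast
    from D have "i = 0 \<or> i = 1 \<or> i = 2" by (auto simp: nu mem_diagram3)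
    then show "(i, j) \<in> ?R"
    proof (elim disjE)
      assume i: "i = 0"
      have "\<not> x < j"
      proof
        assume "x < j"
        then have "(0, j - 1) \<in> ?D" using D i mu nu by (auto simp: mem_diagram3)
        from min[OF this] \<open>x < j\<close> i show False by (simp add: precedes_def)
      qed
      then have "j = x" using D i mu by (auto simp: mem_diagram3)
      then show ?thesis using i D mu nu le
        by (auto simp: mem_diagram3 precedes_def addable_rows_eq grow_def
            diagram3_subset_iff image_iff)
    next
      assume i: "i = 1"
      have "\<not> y < j"
      proof
        assume "y < j"
        then have "(1, j - 1) \<in> ?D" using D i mu nu by (auto simp: mem_diagram3)
        from min[OF this] \<open>y < j\<close> i show False by (simp add: precedes_def)
      qed
      then have "j = y" using D i mu by (auto simp: mem_diagram3)
      then show ?thesis using i D min[of 0 j] mu nu le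
        by (auto simp: mem_diagram3 precedes_def addable_rows_eq grow_def
            diagram3_subset_iff image_iff)
    next
      assume i: "i = 2"
      have "\<not> z < j"
      proof
        assume "z < j"
        then have "(2, j - 1) \<in> ?D" using D i mu nu by (auto simp: mem_diagram3)
        from min[OF this] \<open>z < j\<close> i show False by (simp add: precedes_def)
      qed
      then have "j = z" using D i mu by (auto simp: mem_diagram3)
      then show ?thesis using i D min[of 1 j] mu nu le
        by (auto simp: mem_diagram3 precedes_def addable_rows_eq grow_def
            diagram3_subset_iff image_iff numeral_2_eq_2)
    qed
  next
    assume "(i, j) \<in> ?R"
    then show "(i, j) \<in> ?L" using mu nu le
      by (auto simp: mem_diagram3 precedes_def addable_rows_eq grow_def
          diagram3_subset_iff numeral_2_eq_2 split: if_splits)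
  qed
  then show ?thesis by auto
qed

lemma card_skew_SYT_rec:
  assumes "partition3 \<mu>" "partition3 \<nu>" "diagram \<mu> \<subset> diagram \<nu>"
  shows "card (skew_SYT \<nu> \<mu>) =
    (\<Sum>i\<in>{i \<in> addable_rows \<mu>. diagram (grow \<mu> i) \<subseteq> diagram \<nu>}. card (skew_SYT \<nu> (grow \<mu> i)))"
proof -
  have "card (skew_SYT \<nu> \<mu>) =
    (\<Sum>c\<in>{c \<in> diagram \<nu> - diagram \<mu>. \<forall>x\<in>diagram \<nu> - diagram \<mu>. \<not> precedes x c}.
       card (linear_extensions precedes (diagram \<nu> - diagram \<mu> - {c})))"
    unfolding skew_SYT_eq
    by (rule card_linear_extensions_rec) (use assms(3) finite_diagram in auto)
  also have "\<dots> = (\<Sum>i\<in>{i \<in> addable_rows \<mu>. diagram (grow \<mu> i) \<subseteq> diagram \<nu>}.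
       card (linear_extensions precedes (diagram \<nu> - diagram \<mu> - {(i, \<mu> ! i)})))"
    using assms by (subst minimal_cells_eq) (auto simp: sum.reindex inj_on_def)
  also have "\<dots> = (\<Sum>i\<in>{i \<in> addable_rows \<mu>. diagram (grow \<mu> i) \<subseteq> diagram \<nu>}.
       card (skew_SYT \<nu> (grow \<mu> i)))"
  proof (rule sum.cong)
    fix i assume "i \<in> {i \<in> addable_rows \<mu>. diagram (grow \<mu> i) \<subseteq> diagram \<nu>}"
    then have "i < length \<mu>" using assms(1) by (auto simp: addable_rows_def partition3_def)
    then show "card (linear_extensions precedes (diagram \<nu> - diagram \<mu> - {(i, \<mu> ! i)})) =
        card (skew_SYT \<nu> (grow \<mu> i))"
      by (simp add: skew_SYT_eq diagram_grow Diff_insert[symmetric])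
  qed simp
  finally show ?thesis .
qed

definition outer_shapes :: "nat list \<Rightarrow> nat \<Rightarrow> nat list set" where
  "outer_shapes \<mu> m =
     {\<nu>. partition3 \<nu> \<and> sum_list \<nu> = sum_list \<mu> + m \<and> diagram \<mu> \<subseteq> diagram \<nu>}"

lemma finite_outer_shapes: "finite (outer_shapes \<mu> m)"
proof (rule finite_subset)
  show "outer_shapes \<mu> m \<subseteq> {\<nu>. set \<nu> \<subseteq> {..sum_list \<mu> + m} \<and> length \<nu> = 3}"
    by (auto simp: outer_shapes_def partition3_def dest: member_le_sum_list)
qed (rule finite_lists_length_eq, simp)

lemma finite_skew_SYT: "finite (skew_SYT \<nu> \<mu>)"
  by (simp add: skew_SYT_eq finite_linear_extensions finite_diagram)

lemma finite_strip_SYT: "finite (strip_SYT \<mu> m)"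
  unfolding strip_SYT_def outer_shapes_def[symmetric]
  by (simp add: finite_outer_shapes finite_skew_SYT)

lemma card_strip_SYT:
  "card (strip_SYT \<mu> m) = (\<Sum>\<nu>\<in>outer_shapes \<mu> m. card (skew_SYT \<nu> \<mu>))"
  unfolding strip_SYT_def outer_shapes_def[symmetric]
  by (simp add: finite_outer_shapes finite_skew_SYT)

lemma card_strip_SYT_0:
  assumes "partition3 \<mu>"
  shows "card (strip_SYT \<mu> 0) = 1"
proof -
  have "outer_shapes \<mu> 0 = {\<mu>}"
    using assms by (auto simp: outer_shapes_def partition3_iff diagram3_subset_iff)
  then show ?thesis by (simp add: card_strip_SYT skew_SYT_eq linear_extensions_empty)
qed

text \<open>
  Fixing the outer shape, the smallest entry is moved into the inner shape; then the two
  summations, over the outer shape and over the row of that entry, are exchanged.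
\<close>

lemma card_strip_SYT_Suc:
  assumes mu: "partition3 \<mu>"
  shows "card (strip_SYT \<mu> (Suc m)) = (\<Sum>i\<in>addable_rows \<mu>. card (strip_SYT (grow \<mu> i) m))"
proof -
  have fin: "finite (addable_rows \<mu>)" by (simp add: addable_rows_def)
  have outer: "{\<nu> \<in> outer_shapes \<mu> (Suc m). diagram (grow \<mu> i) \<subseteq> diagram \<nu>} =
      outer_shapes (grow \<mu> i) m" if "i \<in> addable_rows \<mu>" for i
  proof -
    have "i < length \<mu>" using that mu by (simp add: addable_rows_def partition3_def)
    then show ?thesis by (auto simp: outer_shapes_def sum_list_grow diagram_grow)
  qed
  have "card (strip_SYT \<mu> (Suc m)) = (\<Sum>\<nu>\<in>outer_shapes \<mu> (Suc m).
      \<Sum>i\<in>{i \<in> addable_rows \<mu>. diagram (grow \<mu> i) \<subseteq> diagram \<nu>}. card (skew_SYT \<nu> (grow \<mu> i)))"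
    unfolding card_strip_SYT
  proof (rule sum.cong)
    fix \<nu> assume "\<nu> \<in> outer_shapes \<mu> (Suc m)"
    then have "partition3 \<nu>" "diagram \<mu> \<subseteq> diagram \<nu>" "sum_list \<nu> \<noteq> sum_list \<mu>"
      by (auto simp: outer_shapes_def)
    moreover from this mu have "diagram \<mu> \<noteq> diagram \<nu>"
      using diagram_inject by blast
    ultimately show "card (skew_SYT \<nu> \<mu>) =
        (\<Sum>i\<in>{i \<in> addable_rows \<mu>. diagram (grow \<mu> i) \<subseteq> diagram \<nu>}. card (skew_SYT \<nu> (grow \<mu> i)))"
      using mu by (intro card_skew_SYT_rec) auto
  qed simp
  also have "\<dots> = (\<Sum>i\<in>addable_rows \<mu>.
      \<Sum>\<nu>\<in>{\<nu> \<in> outer_shapes \<mu> (Suc m). diagram (grow \<mu> i) \<subseteq> diagram \<nu>}.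
        card (skew_SYT \<nu> (grow \<mu> i)))"
    by (rule sum.swap_restrict[OF finite_outer_shapes fin])
  also have "\<dots> = (\<Sum>i\<in>addable_rows \<mu>. card (strip_SYT (grow \<mu> i) m))"
    unfolding card_strip_SYT by (rule sum.cong) (simp_all add: outer)
  finally show ?thesis .
qed

section \<open>Descending Motzkin paths\<close>

text \<open>
  \<open>descents m h\<close> counts the paths of \<open>m\<close> Motzkin steps from height \<open>h\<close> to height \<open>0\<close> that
  stay nonnegative (\<open>card_descending_paths\<close>).
\<close>

fun descents :: "nat \<Rightarrow> nat \<Rightarrow> nat" where
  "descents 0 h = (if h = 0 then 1 else 0)"
| "descents (Suc m) h =
     descents m (Suc h) + descents m h + (if h = 0 then 0 else descents m (h - 1))"

text \<open>
  The starting height is an integer, so that a down step at height \<open>0\<close> leads to the empty set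
  of paths at height \<open>-1\<close> and needs no separate case.
\<close>

definition descending_paths :: "int \<Rightarrow> nat \<Rightarrow> int list set" where
  "descending_paths h n =
     {p. length p = n \<and> set p \<subseteq> {1, 0, -1} \<and>
         (\<forall>k\<le>n. 0 \<le> h + sum_list (take k p)) \<and> h + sum_list p = 0}"

lemma descending_paths_neg: "h < 0 \<Longrightarrow> descending_paths h n = {}"
  by (force simp: descending_paths_def)

lemma descending_paths_Suc:
  assumes "h \<ge> 0"
  shows "descending_paths h (Suc n) = (\<Union>s\<in>{1, 0, -1}. (#) s ` descending_paths (h + s) n)"
proof -
  have all: "(\<forall>k\<le>Suc n. P k) \<longleftrightarrow> P 0 \<and> (\<forall>k\<le>n. P (Suc k))" for P
    by (metis Suc_le_mono not0_implies_Suc le0)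
  have "p \<in> descending_paths h (Suc n) \<longleftrightarrow>
      p \<in> (\<Union>s\<in>{1, 0, -1}. (#) s ` descending_paths (h + s) n)" for p
  proof (cases p)
    case Nil then show ?thesis by (auto simp: descending_paths_def)
  next
    case (Cons s q)
    then show ?thesis
      using assms by (auto simp: descending_paths_def all add.assoc image_iff)
  qed
  then show ?thesis by blast
qed

lemma card_descending_paths:
  "finite (descending_paths (int h) n) \<and> card (descending_paths (int h) n) = descents n h"
proof (induction n arbitrary: h)
  case 0
  have "descending_paths (int h) 0 = (if h = 0 then {[]} else {})"
    by (auto simp: descending_paths_def)
  then show ?case by simp
next
  case (Suc n)
  have up: "int h + 1 = int (Suc h)" by simp
  have down: "finite (descending_paths (int h - 1) n) \<and>
      card (descending_paths (int h - 1) n) = (if h = 0 then 0 else descents n (h - 1))"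
    using Suc.IH[of "h - 1"] by (cases h) (auto simp: descending_paths_neg)
  have "descending_paths (int h) (Suc n) = (#) 1 ` descending_paths (int h + 1) n \<union>
      ((#) 0 ` descending_paths (int h) n \<union> (#) (-1) ` descending_paths (int h - 1) n)"
    by (simp add: descending_paths_Suc)
  moreover have "card \<dots> = card ((#) 1 ` descending_paths (int h + 1) n) +
      (card ((#) 0 ` descending_paths (int h) n) + card ((#) (-1) ` descending_paths (int h - 1) n))"
    using Suc.IH[of h] Suc.IH[of "Suc h"] down unfolding up
    by (subst card_Un_disjoint; (subst card_Un_disjoint)?) auto
  ultimately show ?case
    using Suc.IH[of h] Suc.IH[of "Suc h"] down unfolding up by (simp add: card_image)
qed

lemma motzkin_paths_eq: "motzkin_paths n = descending_paths 0 n"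
  by (simp add: motzkin_paths_def descending_paths_def)

lemma finite_motzkin_paths: "finite (motzkin_paths n)"
  and card_motzkin_paths: "card (motzkin_paths n) = descents n 0"
  using card_descending_paths[of 0 n] by (simp_all add: motzkin_paths_eq)

text \<open>
  Cutting a path from height \<open>h\<close> at its \<open>h\<close> first descents to a new level leaves \<open>h + 1\<close>
  Motzkin paths, whence \<open>x\<^bsup>h\<^esup> M\<^bsup>h+1\<^esup>\<close>. It suffices that these series satisfy the
  recursion of \<open>descents\<close>, which is \<open>M = 1 + x M + x\<^sup>2 M\<^sup>2\<close> times \<open>x\<^bsup>h\<^esup> M\<^bsup>h\<^esup>\<close>.
\<close>

lemma descents_gf:
  "real (descents m h) = fps_nth (fps_X ^ h * motzkin_gf ^ Suc h) m"
proof (induction m arbitrary: h)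
  case 0
  have "fps_nth motzkin_gf 0 = 1"
    by (subst motzkin_gf_eq) (simp add: power2_eq_square)
  then show ?case by (simp add: fps_nth_power_0)
next
  case (Suc m)
  let ?M = motzkin_gf
  let ?E = "\<lambda>h. fps_X ^ h * ?M ^ Suc h"
  show ?case
  proof (cases h)
    case 0
    have "?M = 1 + fps_X * (?E 1 + ?E 0)"
      by (subst motzkin_gf_eq) (simp add: algebra_simps power2_eq_square)
    then have "fps_nth (?E 0) (Suc m) = fps_nth (1 + fps_X * (?E 1 + ?E 0)) (Suc m)" by simp
    then show ?thesis using 0 Suc.IH by simp
  next
    case (Suc k)
    have "?E h = fps_X * (?E (Suc h) + ?E h + ?E k)"
    proof -
      have "?E h = fps_X ^ h * ?M ^ h * ?M" by simp
      also have "\<dots> = fps_X ^ h * ?M ^ h * (1 + fps_X * ?M + fps_X ^ 2 * ?M ^ 2)"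
        by (rule arg_cong[OF motzkin_gf_eq])
      also have "\<dots> = fps_X * (?E (Suc h) + ?E h + ?E k)"
        using Suc by (simp add: algebra_simps power2_eq_square)
      finally show ?thesis .
    qed
    then have "fps_nth (?E h) (Suc m) = fps_nth (fps_X * (?E (Suc h) + ?E h + ?E k)) (Suc m)"
      by (rule arg_cong)
    then show ?thesis using Suc Suc.IH by (simp del: power_Suc)
  qed
qed

lemma motzkin_eq_descents: "motzkin n = real (descents n 0)"
  using descents_gf[of n 0] by (simp add: motzkin_def)

section \<open>Tableaux as descending paths\<close>

text \<open>
  A shape \<open>[x, y, z]\<close> has the bounds \<open>A = x - y + 1\<close> and \<open>B = y - z + 1\<close>. With this
  offset, a new cell that destroys \<open>x \<ge> y\<close> or \<open>y \<ge> z\<close> leads to \<open>A = 0\<close> or \<open>B = 0\<close>, where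
  the sum is empty, so the recursion below has no boundary cases.
\<close>

definition descent_sum :: "nat \<Rightarrow> nat \<Rightarrow> nat \<Rightarrow> nat" where
  "descent_sum m A B = (\<Sum>i<A. \<Sum>j<B. descents m (i + j))"

lemma descent_sum_0: "descent_sum 0 (Suc A) (Suc B) = 1"
  by (simp add: descent_sum_def sum.lessThan_Suc_shift del: sum.lessThan_Suc)

text \<open>
  The three terms on the right are what becomes of \<open>A\<close> and \<open>B\<close> when a cell is added to the
  first, second or third row. Induction on \<open>A\<close> reduces the identity
  to one between single rows of the double sums.
\<close>

lemma descent_sum_Suc:
  "descent_sum (Suc m) (Suc A) (Suc B) =
     descent_sum m (Suc (Suc A)) (Suc B) + descent_sum m A (Suc (Suc B)) + descent_sum m (Suc A) B"
proof (induction A)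
  case 0
  have "(\<Sum>j<Suc B. if j = 0 then 0 else descents m (j - 1)) = (\<Sum>j<B. descents m j)"
    by (simp add: sum.lessThan_Suc_shift del: sum.lessThan_Suc)
  then show ?case
    by (simp add: descent_sum_def sum.distrib del: sum.lessThan_Suc)
       (simp add: sum.distrib)
next
  case (Suc A)
  have row: "descent_sum m' (Suc A') B' = descent_sum m' A' B' + (\<Sum>j<B'. descents m' (A' + j))"
    for m' A' B' by (simp add: descent_sum_def)
  \<comment> \<open>The surplus term \<open>j = Suc B\<close> of the middle sum fills the gap \<open>j = B\<close> of the last one.\<close>
  have "(\<Sum>j<Suc B. descents (Suc m) (Suc A + j)) =
      (\<Sum>j<Suc B. descents m (Suc (Suc A) + j)) + (\<Sum>j<Suc (Suc B). descents m (A + j)) +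
      (\<Sum>j<B. descents m (Suc A + j))"
    by (simp add: sum.distrib)
  then show ?case
    using Suc.IH row[of "Suc m" "Suc A" "Suc B"] row[of m "Suc (Suc A)" "Suc B"]
      row[of m A "Suc (Suc B)"] row[of m "Suc A" B] by linarith
qed

text \<open>
  Only the differences \<open>x - y\<close> and \<open>y - z\<close> matter, and they enter symmetrically: adding a cell
  changes them as prescribed by the recursion of the double sum.
\<close>

lemma card_strip_SYT_eq_descent_sum:
  assumes "z \<le> y" "y \<le> x"
  shows "card (strip_SYT [x, y, z] m) = descent_sum m (Suc (x - y)) (Suc (y - z))"
  using assms
proof (induction m arbitrary: x y z)
  case 0
  then show ?case by (simp add: card_strip_SYT_0 partition3_iff descent_sum_0)
next
  case (Suc m)
  have p: "partition3 [x, y, z]" using Suc.prems by (simp add: partition3_iff)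
  have e1: "card (strip_SYT [Suc x, y, z] m) = descent_sum m (Suc (Suc (x - y))) (Suc (y - z))"
    using Suc.IH[of z y "Suc x"] Suc.prems by (simp add: Suc_diff_le)
  have e2: "(if y < x then card (strip_SYT [x, Suc y, z] m) else 0) =
      descent_sum m (x - y) (Suc (Suc (y - z)))"
    using Suc.IH[of z "Suc y" x] Suc.prems
    by (auto simp: Suc_diff_le Suc_diff_Suc descent_sum_def simp del: sum.lessThan_Suc)
  have e3: "(if z < y then card (strip_SYT [x, y, Suc z] m) else 0) =
      descent_sum m (Suc (x - y)) (y - z)"
    using Suc.IH[of "Suc z" y x] Suc.prems
    by (auto simp: Suc_diff_Suc descent_sum_def simp del: sum.lessThan_Suc)
  have "card (strip_SYT [x, y, z] (Suc m)) = card (strip_SYT [Suc x, y, z] m) +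
      (if y < x then card (strip_SYT [x, Suc y, z] m) else 0) +
      (if z < y then card (strip_SYT [x, y, Suc z] m) else 0)"
    unfolding card_strip_SYT_Suc[OF p] addable_rows_eq[OF Suc.prems]
    by (simp add: grow_def numeral_2_eq_2)
  then show ?case unfolding e1 e2 e3 descent_sum_Suc .
qed

section \<open>Combinations of shifted Motzkin numbers\<close>

text \<open>
  These combinations shift upwards from \<open>m\<close>, the number of entries of the tableau; seen from
  \<open>n = m + K\<close> they are the shifts \<open>n - k\<close> with \<open>k = K - j\<close>.
\<close>

definition shift_span :: "nat \<Rightarrow> (nat \<Rightarrow> int) set" where
  "shift_span K = {f. \<exists>c. \<forall>m. f m = (\<Sum>j\<le>K. c j * int (descents (m + j) 0))}"

lemma shift_span_zero: "(\<lambda>m. 0) \<in> shift_span K"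
  by (auto simp: shift_span_def intro!: exI[of _ "\<lambda>_. 0"])

lemma shift_span_add:
  assumes "f \<in> shift_span K" "g \<in> shift_span K"
  shows "(\<lambda>m. f m + g m) \<in> shift_span K"
proof -
  obtain c d where "\<forall>m. f m = (\<Sum>j\<le>K. c j * int (descents (m + j) 0))"
    "\<forall>m. g m = (\<Sum>j\<le>K. d j * int (descents (m + j) 0))"
    using assms by (auto simp: shift_span_def)
  then show ?thesis unfolding shift_span_def
    by (auto intro!: exI[of _ "\<lambda>j. c j + d j"] simp: sum.distrib ring_distribs)
qed

lemma shift_span_uminus:
  assumes "f \<in> shift_span K"
  shows "(\<lambda>m. - f m) \<in> shift_span K"
proof -
  obtain c where "\<forall>m. f m = (\<Sum>j\<le>K. c j * int (descents (m + j) 0))"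
    using assms by (auto simp: shift_span_def)
  then show ?thesis unfolding shift_span_def
    by (auto intro!: exI[of _ "\<lambda>j. - c j"] simp: sum_negf)
qed

lemma shift_span_diff:
  assumes "f \<in> shift_span K" "g \<in> shift_span K"
  shows "(\<lambda>m. f m - g m) \<in> shift_span K"
  using shift_span_add[OF assms(1) shift_span_uminus[OF assms(2)]] by simp

lemma shift_span_sum:
  assumes "\<And>i. i \<in> I \<Longrightarrow> f i \<in> shift_span K"
  shows "(\<lambda>m. \<Sum>i\<in>I. f i m) \<in> shift_span K"
  using assms
  by (induction I rule: infinite_finite_induct) (auto intro: shift_span_zero shift_span_add)

lemma shift_span_mono:
  assumes "f \<in> shift_span K" "K \<le> L"
  shows "f \<in> shift_span L"
proof -
  obtain c where c: "\<And>m. f m = (\<Sum>j\<le>K. c j * int (descents (m + j) 0))"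
    using assms by (auto simp: shift_span_def)
  have "f m = (\<Sum>j\<le>L. (if j \<le> K then c j else 0) * int (descents (m + j) 0))" for m
    unfolding c using assms(2) by (intro sum.mono_neutral_cong_left) auto
  then show ?thesis unfolding shift_span_def
    by (intro CollectI exI[of _ "\<lambda>j. if j \<le> K then c j else 0"] allI)
qed

lemma shift_span_shift:
  assumes "f \<in> shift_span K"
  shows "(\<lambda>m. f (Suc m)) \<in> shift_span (Suc K)"
proof -
  obtain c where c: "\<And>m. f m = (\<Sum>j\<le>K. c j * int (descents (m + j) 0))"
    using assms by (auto simp: shift_span_def)
  have "f (Suc m) = (\<Sum>j\<le>Suc K. (case j of 0 \<Rightarrow> 0 | Suc i \<Rightarrow> c i) * int (descents (m + j) 0))" for m
    unfolding c by (subst sum.atMost_Suc_shift) simp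
  then show ?thesis unfolding shift_span_def by blast
qed

text \<open>
  Solve the recursion of \<open>descents (m + 1) h\<close> for its term of greatest height: going one level up
  costs one shift.
\<close>

lemma descents_in_shift_span: "(\<lambda>m. int (descents m h)) \<in> shift_span h"
proof (induction h rule: less_induct)
  case (less h)
  show ?case
  proof (cases h)
    case 0
    then show ?thesis by (auto simp: shift_span_def intro!: exI[of _ "\<lambda>_. 1"])
  next
    case (Suc k)
    have low: "(\<lambda>m. int (if k = 0 then 0 else descents m (k - 1))) \<in> shift_span h"
    proof (cases "k = 0")
      case False
      then show ?thesis using shift_span_mono[OF less.IH[of "k - 1"], of h] Suc by simp
    qed (simp add: shift_span_zero)
    have same: "(\<lambda>m. int (descents m k)) \<in> shift_span h"
      using shift_span_mono[OF less.IH[of k], of h] Suc by simp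
    have next_m: "(\<lambda>m. int (descents (Suc m) k)) \<in> shift_span h"
      using shift_span_shift[OF less.IH[of k]] Suc by simp
    have "(\<lambda>m. int (descents (Suc m) k) - int (descents m k) -
        int (if k = 0 then 0 else descents m (k - 1))) \<in> shift_span h"
      by (rule shift_span_diff[OF shift_span_diff[OF next_m same] low])
    moreover have "(\<lambda>m. int (descents m h)) =
        (\<lambda>m. int (descents (Suc m) k) - int (descents m k) -
          int (if k = 0 then 0 else descents m (k - 1)))"
      using Suc by (simp add: fun_eq_iff)
    ultimately show ?thesis by simp
  qed
qed

lemma descent_sum_in_shift_span:
  assumes "a + b \<le> K"
  shows "(\<lambda>m. int (descent_sum m (Suc a) (Suc b))) \<in> shift_span K"
  unfolding descent_sum_def of_nat_sum
  using assms by (intro shift_span_sum shift_span_mono[OF descents_in_shift_span]) auto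

section \<open>Signed counts and bijections\<close>

text \<open>
  An identity with signs becomes one between finite sets once every family of copies with a negative
  coefficient is moved to the other side: \<open>c = nat c - nat (- c)\<close> for each integer \<open>c\<close>.
\<close>

lemma signed_sum_bij_betw:
  fixes c :: "'k \<Rightarrow> int"
  assumes "finite A" "finite K" "\<And>k. k \<in> K \<Longrightarrow> finite (P k)"
    and card_A: "int (card A) = (\<Sum>k\<in>K. c k * int (card (P k)))"
  shows "\<exists>f. bij_betw f (A <+> (SIGMA k:K. {..<nat (- c k)} \<times> P k)) (SIGMA k:K. {..<nat (c k)} \<times> P k)"
proof (rule finite_same_card_bij)
  have split: "int (nat (c k)) = c k + int (nat (- c k))" for k by simp
  have "int (card A) + (\<Sum>k\<in>K. int (nat (- c k)) * int (card (P k))) =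
      (\<Sum>k\<in>K. int (nat (c k)) * int (card (P k)))"
    unfolding card_A split by (simp add: sum.distrib ring_distribs)
  then have "card A + (\<Sum>k\<in>K. nat (- c k) * card (P k)) = (\<Sum>k\<in>K. nat (c k) * card (P k))"
    by (simp only: flip: of_nat_mult of_nat_sum of_nat_add)
  then show "card (A <+> (SIGMA k:K. {..<nat (- c k)} \<times> P k)) = card (SIGMA k:K. {..<nat (c k)} \<times> P k)"
    using assms by (simp add: card_Plus card_cartesian_product)
qed (use assms in auto)

theorem theorem3p3:
  fixes \<mu> :: "nat list"
  assumes "partition3 \<mu>"
  shows "\<exists>c :: nat \<Rightarrow> int. \<forall>n\<ge>sum_list \<mu>.
           real (card (strip_SYT \<mu> (n - sum_list \<mu>))) =
             (\<Sum>k\<le>sum_list \<mu>. of_int (c k) * motzkin (n - k)) \<and>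
           (\<exists>f. bij_betw f
             (strip_SYT \<mu> (n - sum_list \<mu>) <+>
                (SIGMA k:{..sum_list \<mu>}. {..<nat (- c k)} \<times> motzkin_paths (n - k)))
             (SIGMA k:{..sum_list \<mu>}. {..<nat (c k)} \<times> motzkin_paths (n - k)))"
proof -
  obtain x y z where mu: "\<mu> = [x, y, z]" "z \<le> y" "y \<le> x"
    using assms by (auto simp: partition3_iff)
  let ?s = "sum_list \<mu>"
  have "(\<lambda>m. int (card (strip_SYT \<mu> m))) \<in> shift_span ?s"
    unfolding mu(1) card_strip_SYT_eq_descent_sum[OF mu(2,3)]
    by (rule descent_sum_in_shift_span) (use mu in auto)
  then obtain d where d: "\<And>m. int (card (strip_SYT \<mu> m)) =
      (\<Sum>j\<le>?s. d j * int (descents (m + j) 0))"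
    by (auto simp: shift_span_def)
  define c where "c k = d (?s - k)" for k
  have int_eq: "int (card (strip_SYT \<mu> (n - ?s))) =
      (\<Sum>k\<le>?s. c k * int (card (motzkin_paths (n - k))))" if "n \<ge> ?s" for n
  proof -
    have "int (card (strip_SYT \<mu> (n - ?s))) =
        (\<Sum>k\<le>?s. d (?s - k) * int (descents (n - ?s + (?s - k)) 0))"
      unfolding d by (rule sum.reindex_bij_witness[of _ "\<lambda>k. ?s - k" "\<lambda>k. ?s - k"]) auto
    also have "\<dots> = (\<Sum>k\<le>?s. c k * int (card (motzkin_paths (n - k))))"
      using that by (intro sum.cong) (auto simp: c_def card_motzkin_paths)
    finally show ?thesis .
  qed
  show ?thesis
  proof (intro exI[of _ c] allI impI conjI)
    fix n assume n: "n \<ge> ?s"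
    have "real_of_int (int (card (strip_SYT \<mu> (n - ?s)))) =
        (\<Sum>k\<le>?s. of_int (c k) * motzkin (n - k))"
      unfolding int_eq[OF n] by (simp add: card_motzkin_paths motzkin_eq_descents)
    then show "real (card (strip_SYT \<mu> (n - ?s))) = (\<Sum>k\<le>?s. of_int (c k) * motzkin (n - k))"
      by simp
    show "\<exists>f. bij_betw f
        (strip_SYT \<mu> (n - ?s) <+> (SIGMA k:{..?s}. {..<nat (- c k)} \<times> motzkin_paths (n - k)))
        (SIGMA k:{..?s}. {..<nat (c k)} \<times> motzkin_paths (n - k))"
      by (rule signed_sum_bij_betw)
         (simp_all add: finite_strip_SYT finite_motzkin_paths int_eq[OF n])
  qed
qed

end
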